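(* The Vinberg cone $$\left\{(y_1,y_2,y_3,y_4,y_5)\in\mathbb{R}^5 \;\middle|\; \begin{pmatrix} y_1 & y_2\\ y_2 & y_4\end{pmatrix}\succeq 0,\ \begin{pmatrix} y_1 & y_3\\ y_3 & y_5\end{pmatrix}\succeq 0\right\}$$ is not realizable as a rank-one generated (ROG) hyperbolicity cone.
   Context: A homogeneous polynomial $p$ on a finite-dimensional real Euclidean space $\mathcal{V}$ is hyperbolic along $e\in\mathcal{V}$ if $p(e)>0$ and for every $x\in\mathcal{V}$ the univariate polynomial $t\mapsto p(x-te)$ has only real roots; its hyperbolicity cone is $\Lambda_+(p,e)=\{x\in\mathcal{V}\mid \text{all roots of } t\mapsto p(te-x) \text{ are nonnegative}\}$. The rank of $x\in\mathcal{V}$ (with respect to $p$ and $e$) is the number of nonzero roots, counted with multiplicity, of $t\mapsto p(te-x)$. $\Lambda_+(p,e)$ is rank-one generated (ROG) with respect to $p$ if all its extreme rays are generated by elements of rank $1$. A closed convex cone $K\subseteq \mathcal{V}$ is realizable as a ROG hyperbolicity cone if there exist $p$ and $e$, with $p$ hyperbolic along $e$, such that $K=\Lambda_+(p,e)$ and $\Lambda_+(p,e)$ is ROG with respect to $p$. Here $\mathcal{V}=\mathbb{R}^5$. *)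

theory Defs
  imports "HOL-Analysis.Analysis" "HOL-Computational_Algebra.Computational_Algebra"
begin

text \<open>
  A real form is represented by the polynomial function it induces, which determines it
  because the base field is infinite. The degree may be 0.
\<close>

definition homogeneous_polynomial :: "('a::euclidean_space \<Rightarrow> real) \<Rightarrow> bool" where
  "homogeneous_polynomial p \<longleftrightarrow>
     real_polynomial_function p \<and> (\<exists>d::nat. \<forall>c x. p (c *\<^sub>R x) = c ^ d * p x)"

definition line_poly :: "('a::euclidean_space \<Rightarrow> real) \<Rightarrow> 'a \<Rightarrow> 'a \<Rightarrow> real poly" where
  "line_poly p a b = (THE q. \<forall>t. poly q t = p (a + t *\<^sub>R b))"

lemma poly_line_poly:
  assumes "real_polynomial_function p"
  shows "poly (line_poly p a b) t = p (a + t *\<^sub>R b)"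
proof -
  have ex: "\<exists>q. \<forall>t. poly q t = p (a + t *\<^sub>R b)"
    using assms
  proof induction
    case (linear f)
    interpret bounded_linear f by (fact linear)
    have "\<forall>t. poly [:f a, f b:] t = f (a + t *\<^sub>R b)" by (simp add: add scaleR)
    then show ?case by blast
  next
    case (const c)
    have "\<forall>t. poly [:c:] t = c" by simp
    then show ?case by blast
  next
    case (add f g)
    then show ?case by (metis poly_add)
  next
    case (mult f g)
    then show ?case by (metis poly_mult)
  qed
  have "\<exists>!q. \<forall>t. poly q t = p (a + t *\<^sub>R b)"
  proof (rule ex_ex1I[OF ex])
    fix q r :: "real poly"
    assume "\<forall>t. poly q t = p (a + t *\<^sub>R b)" "\<forall>t. poly r t = p (a + t *\<^sub>R b)"
    then have "poly q = poly r" by auto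
    then show "q = r" by (simp only: poly_eq_poly_eq_iff)
  qed
  from theI'[OF this] show ?thesis unfolding line_poly_def by blast
qed

text \<open>
  Roots are always complex roots: \<open>has only real roots\<close> is a condition on the
  factorisation over the complex numbers.
\<close>

definition complex_roots :: "real poly \<Rightarrow> complex multiset" where
  "complex_roots q = proots (map_poly complex_of_real q)"

definition hyperbolic_along :: "('a::euclidean_space \<Rightarrow> real) \<Rightarrow> 'a \<Rightarrow> bool" where
  "hyperbolic_along p e \<longleftrightarrow>
     homogeneous_polynomial p \<and> p e > 0 \<and>
     (\<forall>x. \<forall>z \<in># complex_roots (line_poly p x (- e)). z \<in> \<real>)"

definition hyperbolicity_cone :: "('a::euclidean_space \<Rightarrow> real) \<Rightarrow> 'a \<Rightarrow> 'a set" where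
  "hyperbolicity_cone p e =
     {x. \<forall>z \<in># complex_roots (line_poly p (- x) e). z \<in> \<real>\<^sub>\<ge>\<^sub>0}"

definition hyperbolic_rank :: "('a::euclidean_space \<Rightarrow> real) \<Rightarrow> 'a \<Rightarrow> 'a \<Rightarrow> nat" where
  "hyperbolic_rank p e x =
     size (filter_mset (\<lambda>z. z \<noteq> 0) (complex_roots (line_poly p (- x) e)))"

text \<open>For a single vector, \<open>cone hull {x}\<close> is the half-line of nonnegative multiples of it.\<close>

definition extreme_ray_of :: "'a::euclidean_space set \<Rightarrow> 'a set \<Rightarrow> bool" where
  "extreme_ray_of R K \<longleftrightarrow> R face_of K \<and> (\<exists>x. x \<noteq> 0 \<and> R = cone hull {x})"

definition rank_one_generated :: "('a::euclidean_space \<Rightarrow> real) \<Rightarrow> 'a \<Rightarrow> bool" where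
  "rank_one_generated p e \<longleftrightarrow>
     (\<forall>R. extreme_ray_of R (hyperbolicity_cone p e) \<longrightarrow>
        (\<exists>x. R = cone hull {x} \<and> hyperbolic_rank p e x = 1))"

definition ROG_realizable :: "'a::euclidean_space set \<Rightarrow> bool" where
  "ROG_realizable K \<longleftrightarrow>
     (\<exists>p e. hyperbolic_along p e \<and> K = hyperbolicity_cone p e \<and> rank_one_generated p e)"

definition positive_semidefinite :: "real ^ 'n ^ 'n \<Rightarrow> bool" where
  "positive_semidefinite A \<longleftrightarrow> transpose A = A \<and> (\<forall>v. 0 \<le> v \<bullet> (A *v v))"

text \<open>
  The index type \<open>5\<close> is the integers modulo 5, so \<open>y $ 5\<close> is the coordinate
  at \<open>0\<close> and \<open>1, ..., 5\<close> are its five distinct elements.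
\<close>

definition Vinberg_cone :: "(real ^ 5) set" where
  "Vinberg_cone =
     {y. positive_semidefinite (vector [vector [y $ 1, y $ 2], vector [y $ 2, y $ 4]] :: real ^ 2 ^ 2) \<and>
         positive_semidefinite (vector [vector [y $ 1, y $ 3], vector [y $ 3, y $ 5]] :: real ^ 2 ^ 2)}"

text \<open>
  \<open>ROG_realizable\<close> is meant for closed convex cones; the Vinberg cone is one.
\<close>

lemma mem_Vinberg_cone:
  "y \<in> Vinberg_cone \<longleftrightarrow>
     (\<forall>a b. 0 \<le> y $ 1 * a\<^sup>2 + 2 * y $ 2 * a * b + y $ 4 * b\<^sup>2) \<and>
     (\<forall>a b. 0 \<le> y $ 1 * a\<^sup>2 + 2 * y $ 3 * a * b + y $ 5 * b\<^sup>2)"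
proof -
  have psd: "positive_semidefinite (vector [vector [r, s], vector [s, t]] :: real ^ 2 ^ 2) \<longleftrightarrow>
      (\<forall>a b. 0 \<le> r * a\<^sup>2 + 2 * s * a * b + t * b\<^sup>2)" (is "?L \<longleftrightarrow> ?R") for r s t
  proof -
    have q: "v \<bullet> ((vector [vector [r, s], vector [s, t]] :: real ^ 2 ^ 2) *v v)
        = r * (v $ 1)\<^sup>2 + 2 * s * v $ 1 * v $ 2 + t * (v $ 2)\<^sup>2" for v :: "real ^ 2"
      by (simp add: inner_vec_def matrix_vector_mult_def sum_2 power2_eq_square algebra_simps)
    have sym: "transpose (vector [vector [r, s], vector [s, t]] :: real ^ 2 ^ 2)
        = vector [vector [r, s], vector [s, t]]"
      by (simp add: vec_eq_iff transpose_def forall_2)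
    show ?thesis
    proof
      assume L: ?L
      show ?R
      proof (intro allI)
        fix a b :: real
        show "0 \<le> r * a\<^sup>2 + 2 * s * a * b + t * b\<^sup>2"
          using L q[of "vector [a, b]"] unfolding positive_semidefinite_def by (metis vector_2)
      qed
    next
      assume ?R
      then show ?L unfolding positive_semidefinite_def q using sym by blast
    qed
  qed
  show ?thesis unfolding Vinberg_cone_def mem_Collect_eq psd ..
qed

lemma closed_convex_cone_Vinberg_cone:
  "closed Vinberg_cone" "convex Vinberg_cone" "cone Vinberg_cone"
proof -
  have eq: "Vinberg_cone =
      (\<Inter>a. \<Inter>b. {y. 0 \<le> y $ 1 * a\<^sup>2 + 2 * y $ 2 * a * b + y $ 4 * b\<^sup>2}) \<inter>
      (\<Inter>a. \<Inter>b. {y. 0 \<le> y $ 1 * a\<^sup>2 + 2 * y $ 3 * a * b + y $ 5 * b\<^sup>2})"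
    by (auto simp: mem_Vinberg_cone)
  show "closed Vinberg_cone"
    unfolding eq by (intro closed_Int closed_INT ballI closed_Collect_le continuous_intros)
  have scale: "c *\<^sub>R x \<in> Vinberg_cone" if "x \<in> Vinberg_cone" "0 \<le> c" for x and c :: real
  proof -
    have "(c *\<^sub>R x) $ 1 * a\<^sup>2 + 2 * (c *\<^sub>R x) $ i * a * b + (c *\<^sub>R x) $ j * b\<^sup>2
        = c * (x $ 1 * a\<^sup>2 + 2 * x $ i * a * b + x $ j * b\<^sup>2)" for a b i j
      by (simp add: algebra_simps)
    then show ?thesis using that unfolding mem_Vinberg_cone by simp
  qed
  have plus: "x + y \<in> Vinberg_cone" if "x \<in> Vinberg_cone" "y \<in> Vinberg_cone" for x y
  proof -
    have "(x + y) $ 1 * a\<^sup>2 + 2 * (x + y) $ i * a * b + (x + y) $ j * b\<^sup>2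
        = (x $ 1 * a\<^sup>2 + 2 * x $ i * a * b + x $ j * b\<^sup>2)
        + (y $ 1 * a\<^sup>2 + 2 * y $ i * a * b + y $ j * b\<^sup>2)" for a b i j
      by (simp add: algebra_simps)
    then show ?thesis using that unfolding mem_Vinberg_cone by simp
  qed
  show "cone Vinberg_cone" unfolding cone_def using scale by blast
  show "convex Vinberg_cone" unfolding convex_def using scale plus by blast
qed

end

theory Submission
  imports Defs
begin

text \<open>
  If \<open>x\<close> has rank one, then \<open>p (e + s x)\<close> is affine in \<open>s\<close>. The rank-one
  vectors on the extreme rays \<open>(a\<^sup>2, ab, ac, b\<^sup>2, c\<^sup>2)\<close> with \<open>a \<noteq> 0\<close> converge,
  as \<open>a\<close> tends to 0, to every vector of the quadrant spanned by the last two basis vectors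
  \<open>e\<^sub>4, e\<^sub>5\<close>, so \<open>p\<close> is affine along those directions too. For an affine direction the only
  root other than 1 of \<open>t \<mapsto> p (t e - (e + s x))\<close> is the one given by the affine function, so
  the point where \<open>e + s x\<close> leaves the cone determines \<open>p (e + s x)\<close>. The cone meets the
  affine plane \<open>e + span {e\<^sub>4, e\<^sub>5}\<close> in a translated quadrant with apex \<open>e - m e\<^sub>4 - n e\<^sub>5\<close>,
  which forces \<open>p (e + m e\<^sub>4 + u n e\<^sub>5) = p(e) (1 + max 1 u)\<close> for \<open>u \<ge> 0\<close>; but this is
  not a polynomial in \<open>u\<close>.
\<close>

lemma exhaust_5:
  fixes x :: 5
  shows "x = 1 \<or> x = 2 \<or> x = 3 \<or> x = 4 \<or> x = 5"
proof (induct x)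
  case (of_int z)
  then have "z = 0 \<or> z = 1 \<or> z = 2 \<or> z = 3 \<or> z = 4" by fastforce
  then show ?case by auto
qed

lemma forall_5: "(\<forall>i::5. P i) \<longleftrightarrow> P 1 \<and> P 2 \<and> P 3 \<and> P 4 \<and> P 5"
  by (metis exhaust_5)

text \<open>Extends an identity obtained by dividing by a parameter to the parameter value
  0.\<close>

lemma isCont_eq_at_0:
  fixes f g :: "real \<Rightarrow> real"
  assumes "isCont f 0" "isCont g 0" and eq: "\<And>s. s \<noteq> 0 \<Longrightarrow> f s = g s"
  shows "f 0 = g 0"
proof -
  have f: "f \<midarrow>0\<rightarrow> f 0" and g: "g \<midarrow>0\<rightarrow> g 0" using assms by (auto simp: isCont_def)
  have "f \<midarrow>0\<rightarrow> g 0"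
    by (rule Lim_transform_eventually[OF g]) (auto simp: eventually_at_filter eq)
  then show ?thesis using f LIM_unique by blast
qed

section \<open>Real polynomials and their complex roots\<close>

lemma map_poly_of_real_mult:
  "map_poly complex_of_real (p * q) = map_poly complex_of_real p * map_poly complex_of_real q"
  by (rule poly_eqI) (simp add: coeff_map_poly coeff_mult)

lemma map_poly_of_real_power:
  "map_poly complex_of_real (p ^ n) = map_poly complex_of_real p ^ n"
  by (induction n) (simp_all add: map_poly_of_real_mult map_poly_1)

lemma poly_map_poly_of_real:
  "poly (map_poly complex_of_real p) (complex_of_real t) = complex_of_real (poly p t)"
  by (induction p) (simp_all add: map_poly_pCons)

text \<open>Over the complex numbers the polynomial splits into \<open>k\<close> factors with root 0
  and a single factor with root \<open>z\<close>. No hyperbolicity is assumed, so \<open>z\<close>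
  must be shown to be real.\<close>

lemma poly_of_one_nonzero_root:
  assumes "size (filter_mset (\<lambda>z. z \<noteq> 0) (complex_roots q)) = 1"
  obtains l k m where "l \<noteq> 0" "\<And>t. poly q t = l * t ^ k * (t - m)"
proof -
  define P where "P = map_poly complex_of_real q"
  have q0: "q \<noteq> 0" using assms by (auto simp: complex_roots_def)
  define l where "l = lead_coeff q"
  have l: "l \<noteq> 0" using q0 by (simp add: l_def)
  have lP: "lead_coeff P = complex_of_real l"
    unfolding P_def l_def by (simp add: degree_map_poly coeff_map_poly)
  obtain z where z: "filter_mset (\<lambda>z. z \<noteq> 0) (proots P) = {#z#}"
    using assms unfolding complex_roots_def P_def[symmetric] by (metis size_1_singleton_mset)
  have zeros: "filter_mset (\<lambda>z. \<not> z \<noteq> 0) (proots P) = replicate_mset (count (proots P) 0) 0"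
    by (rule multiset_eqI) simp
  define k where "k = count (proots P) 0"
  have "proots P = {#z#} + replicate_mset k 0"
    using multiset_partition[of "proots P" "\<lambda>z. z \<noteq> 0"] z zeros by (simp add: k_def)
  then have "P = smult (complex_of_real l) ([:-z, 1:] * [:0, 1:] ^ k)"
    using complex_poly_decompose_multiset[of P] lP by simp
  then have PP: "poly P x = complex_of_real l * ((x - z) * x ^ k)" for x
    by (simp add: algebra_simps)
  define m where "m = Re z"
  \<comment> \<open>At 1 the factor \<open>x ^ k\<close> equals 1, so the real value of
    \<open>q\<close> there forces \<open>1 - z\<close>, hence \<open>z\<close>, to be real.\<close>
  have "complex_of_real (poly q 1) = complex_of_real l * (1 - z)"
    using PP[of "complex_of_real 1"] unfolding P_def poly_map_poly_of_real by simp
  then have "Im (complex_of_real l * (1 - z)) = 0" by (metis Im_complex_of_real)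
  then have zm: "z = complex_of_real m" using l by (simp add: m_def complex_eq_iff)
  have "poly q t = l * t ^ k * (t - m)" for t
  proof -
    have "complex_of_real (poly q t) = complex_of_real (l * t ^ k * (t - m))"
      using PP[of "complex_of_real t"] unfolding P_def poly_map_poly_of_real zm by simp
    then show ?thesis by (simp only: of_real_eq_iff)
  qed
  with l show ?thesis using that by blast
qed

section \<open>Homogeneous polynomials along rank-one directions\<close>

lemma isCont_line:
  fixes p :: "'a::euclidean_space \<Rightarrow> real"
  assumes "real_polynomial_function p"
  shows "isCont (\<lambda>s. p (a + s *\<^sub>R b)) x"
proof -
  have "(\<lambda>s. p (a + s *\<^sub>R b)) = poly (line_poly p a b)"
    using poly_line_poly[OF assms] by auto
  then show ?thesis by simp
qed

text \<open>Put \<open>t = 1 / s\<close> in the factorisation of \<open>p (t e - x)\<close> and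
  clear denominators by homogeneity: \<open>p (e - s x)\<close> is a power of \<open>s\<close> times
  an affine function. Its value at \<open>s = 0\<close> is \<open>p e\<close>, which is nonzero, so
  that power is trivial and \<open>d = k + 1\<close>.\<close>

lemma rank_one_affine:
  assumes pol: "real_polynomial_function p" and hom: "\<And>c x. p (c *\<^sub>R x) = c ^ d * p x"
    and pos: "p e > 0" and rank: "hyperbolic_rank p e x = 1"
  shows "d > 0" "\<exists>l. \<forall>s. p (e + s *\<^sub>R x) = p e * (1 + l * s)"
proof -
  obtain l k m where l: "l \<noteq> 0"
    and q: "\<And>t. poly (line_poly p (- x) e) t = l * t ^ k * (t - m)"
    using rank poly_of_one_nonzero_root unfolding hyperbolic_rank_def by metis
  have q': "p (- x + t *\<^sub>R e) = l * t ^ k * (t - m)" for t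
    using q[of t] poly_line_poly[OF pol] by simp
  define r where "r s = p (e + s *\<^sub>R (- x))" for s
  have r: "isCont r 0" unfolding r_def by (rule isCont_line[OF pol])
  have r0: "r 0 = p e" by (simp add: r_def)
  have key: "s ^ Suc k * r s = l * s ^ d * (1 - s * m)" if s: "s \<noteq> 0" for s
  proof -
    have e: "e + s *\<^sub>R (- x) = s *\<^sub>R (- x + (1 / s) *\<^sub>R e)" using s by (simp add: algebra_simps)
    have "r s = s ^ d * (l * (1 / s) ^ k * (1 / s - m))" unfolding r_def e hom q' ..
    then show ?thesis using s by (simp add: field_simps)
  qed
  \<comment> \<open>Compare the orders of vanishing at 0 of both sides of \<open>key\<close>, using \<open>r 0 \<noteq> 0\<close>.\<close>
  have d: "d = Suc k"
  proof (rule ccontr)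
    assume "d \<noteq> Suc k"
    then consider "d < Suc k" | "d > Suc k" by linarith
    then show False
    proof cases
      case 1
      have "s ^ (Suc k - d) * r s = l * (1 - s * m)" if "s \<noteq> 0" for s
      proof -
        have "s ^ d * (s ^ (Suc k - d) * r s) = s ^ d * (l * (1 - s * m))"
          using key[OF that] 1 by (simp flip: power_add mult.assoc)
        then show ?thesis using that by simp
      qed
      then have "0 ^ (Suc k - d) * r 0 = l * (1 - 0 * m)"
        using isCont_eq_at_0[of "\<lambda>s. s ^ (Suc k - d) * r s" "\<lambda>s. l * (1 - s * m)"] r
        by (simp add: continuous_intros)
      then show False using 1 l by (simp add: power_0_left)
    next
      case 2
      have "r s = l * s ^ (d - Suc k) * (1 - s * m)" if "s \<noteq> 0" for s
      proof -
        have "s ^ d = s ^ Suc k * s ^ (d - Suc k)" 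
          using 2 by (metis less_imp_le le_add_diff_inverse power_add)
        then have "s ^ Suc k * r s = s ^ Suc k * (l * s ^ (d - Suc k) * (1 - s * m))"
          using key[OF that] by (simp add: mult_ac)
        then show ?thesis using that by simp
      qed
      then have "r 0 = l * 0 ^ (d - Suc k) * (1 - 0 * m)"
        using isCont_eq_at_0[of r "\<lambda>s. l * s ^ (d - Suc k) * (1 - s * m)"] r
        by (simp add: continuous_intros)
      then show False using 2 r0 pos by (simp add: power_0_left)
    qed
  qed
  then show "d > 0" by simp
  have rs: "r s = l * (1 - s * m)" if "s \<noteq> 0" for s
    using key[OF that] that d by simp
  then have "r 0 = l * (1 - 0 * m)"
    using isCont_eq_at_0[of r "\<lambda>s. l * (1 - s * m)"] r by (simp add: continuous_intros)
  then have le: "l = p e" using r0 by simp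
  have "p (e + s *\<^sub>R x) = p e * (1 + m * s)" for s
  proof (cases "s = 0")
    case False
    then show ?thesis using rs[of "- s"] le by (simp add: r_def mult.commute)
  qed simp
  then show "\<exists>l. \<forall>s. p (e + s *\<^sub>R x) = p e * (1 + l * s)" by blast
qed

text \<open>For \<open>y = e + s x\<close>, homogeneity and \<open>aff\<close> give
  \<open>p (t e - y) = p e * (t - 1) ^ (d - 1) * (t - m)\<close> with \<open>m = 1 + l s\<close>, so
  only the root \<open>m\<close> can be negative.\<close>

lemma hyperbolicity_cone_affine_line:
  assumes pol: "real_polynomial_function p" and hom: "\<And>c x. p (c *\<^sub>R x) = c ^ d * p x"
    and d: "d > 0" and pos: "p e > 0" and aff: "\<And>s. p (e + s *\<^sub>R x) = p e * (1 + l * s)"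
  shows "e + s *\<^sub>R x \<in> hyperbolicity_cone p e \<longleftrightarrow> 0 \<le> 1 + l * s"
proof -
  define m where "m = 1 + l * s"
  define Q where "Q = [:p e:] * ([:-1, 1:] ^ (d - 1) * [:-m, 1:])"
  define y where "y = e + s *\<^sub>R x"
  have off: "p (- y + t *\<^sub>R e) = poly Q t" if t: "t \<noteq> 1" for t
  proof -
    have "(t - 1) * (- s / (t - 1)) = - s" using t by simp
    then have "- y + t *\<^sub>R e = (t - 1) *\<^sub>R (e + (- s / (t - 1)) *\<^sub>R x)"
      unfolding y_def scaleR_add_right scaleR_scaleR by (simp add: scaleR_left_diff_distrib)
    then have "p (- y + t *\<^sub>R e) = (t - 1) ^ d * (p e * (1 + l * (- s / (t - 1))))"
      by (simp only: hom aff)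
    also have "\<dots> = (t - 1) ^ (d - 1) * (p e * ((t - 1) * (1 + l * (- s / (t - 1)))))"
      using d by (cases d) simp_all
    also have "(t - 1) * (1 + l * (- s / (t - 1))) = t - m"
      using t by (simp add: m_def field_simps)
    finally show ?thesis by (simp add: Q_def algebra_simps)
  qed
  \<comment> \<open>The computation in \<open>off\<close> divides by \<open>t - 1\<close>;
    continuity supplies the point \<open>t = 1\<close>.\<close>
  have "p (- y + (1 + 0) *\<^sub>R e) = poly Q (1 + 0)"
  proof (rule isCont_eq_at_0)
    have "isCont (\<lambda>u. p ((- y + e) + u *\<^sub>R e)) 0" by (rule isCont_line[OF pol])
    then show "isCont (\<lambda>u. p (- y + (1 + u) *\<^sub>R e)) 0"
      by (simp add: algebra_simps)
    show "isCont (\<lambda>u. poly Q (1 + u)) 0" by (intro continuous_intros)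
    show "p (- y + (1 + u) *\<^sub>R e) = poly Q (1 + u)" if "u \<noteq> 0" for u
      using off[of "1 + u"] that by simp
  qed
  with off have "poly (line_poly p (- y) e) = poly Q"
    by (metis poly_line_poly[OF pol] add.right_neutral ext)
  then have lp: "line_poly p (- y) e = Q" by (simp only: poly_eq_poly_eq_iff)
  have C: "map_poly complex_of_real Q
      = [:complex_of_real (p e):] * ([:-1, 1:] ^ (d - 1) * [:- complex_of_real m, 1:])"
    by (simp only: Q_def map_poly_of_real_mult map_poly_of_real_power)
      (simp add: map_poly_pCons)
  have "map_poly complex_of_real Q \<noteq> 0" 
    unfolding C mult_eq_0_iff power_eq_0_iff using pos by auto
  then have "set_mset (complex_roots Q) = {z. poly (map_poly complex_of_real Q) z = 0}"
    unfolding complex_roots_def by simp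
  \<comment> \<open>For \<open>d = 1\<close> the factor with root 1 is absent; membership in the
    cone is the same either way, since 1 is nonnegative.\<close>
  also have "\<dots> = {z. (d > 1 \<and> z = 1) \<or> z = complex_of_real m}"
    unfolding C using pos by auto
  finally have "set_mset (complex_roots Q) = {z. (d > 1 \<and> z = 1) \<or> z = complex_of_real m}" .
  then show ?thesis
    unfolding hyperbolicity_cone_def y_def[symmetric] m_def[symmetric] by (auto simp: lp)
qed

section \<open>Extreme rays and a quadrant section of the Vinberg cone\<close>

text \<open>Complete the square. The criterion is written as a lower bound on \<open>t\<close> so
  that varying \<open>t\<close> alone gives a half-line. For \<open>r = 0\<close> the quotient is 0
  by convention and the bound reads \<open>0 \<le> t\<close>.\<close>

lemma psd_form_iff:
  fixes r s t :: real
  shows "(\<forall>a b. 0 \<le> r * a\<^sup>2 + 2 * s * a * b + t * b\<^sup>2)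
     \<longleftrightarrow> 0 \<le> r \<and> (r = 0 \<longrightarrow> s = 0) \<and> s\<^sup>2 / r \<le> t" (is "?L \<longleftrightarrow> ?R")
proof
  assume L: ?L
  have r: "0 \<le> r" using L[rule_format, of 1 0] by simp
  have t: "0 \<le> t" using L[rule_format, of 0 1] by simp
  show ?R
  proof (cases "r = 0")
    case True
    have "s = 0"
    proof (rule ccontr)
      assume s: "s \<noteq> 0"
      \<comment> \<open>The point is chosen to make the form equal to
        \<open>-(t + 1) + t = -1\<close>.\<close>
      have "0 \<le> 2 * s * (- (t + 1) / (2 * s)) + t"
        using L[rule_format, of "- (t + 1) / (2 * s)" 1] True by simp
      then show False using s by simp
    qed
    then show ?thesis using True t by simp
  next
    case False
    then have "0 \<le> t - s\<^sup>2 / r"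
      using L[rule_format, of "- s / r" 1] by (simp add: field_simps power2_eq_square)
    then show ?thesis using r False by simp
  qed
next
  assume R: ?R
  show ?L
  proof (intro allI)
    fix a b
    show "0 \<le> r * a\<^sup>2 + 2 * s * a * b + t * b\<^sup>2"
    proof (cases "r = 0")
      case True
      then show ?thesis using R by simp
    next
      case False
      have "r * a\<^sup>2 + 2 * s * a * b + t * b\<^sup>2
          = r * (a + s / r * b)\<^sup>2 + (t - s\<^sup>2 / r) * b\<^sup>2"
        using False by (simp add: field_simps power2_eq_square)
      then show ?thesis using R by simp
    qed
  qed
qed

text \<open>A positive semidefinite matrix annihilates every vector on which its form vanishes.
  Kernel vector \<open>(b, -a)\<close> makes the matrix a multiple of the rank-one matrix of
  \<open>(a, b)\<close>; step \<open>*\<close> is the kernel equation.\<close>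

lemma psd_form_zero:
  fixes r s t :: real
  assumes "\<forall>a b. 0 \<le> r * a\<^sup>2 + 2 * s * a * b + t * b\<^sup>2"
    and a: "a \<noteq> 0" and zero: "r * b\<^sup>2 + 2 * s * b * (- a) + t * (- a)\<^sup>2 = 0"
  shows "s = r / a\<^sup>2 * (a * b)" "t = r / a\<^sup>2 * b\<^sup>2"
proof -
  have R: "0 \<le> r" "r = 0 \<longrightarrow> s = 0" "s\<^sup>2 / r \<le> t" using assms(1) psd_form_iff by blast+
  have *: "r * b = s * a \<and> s * b = t * a"
  proof (cases "r = 0")
    case True
    then show ?thesis using R zero a by simp
  next
    case False
    have "r * b\<^sup>2 + 2 * s * b * (- a) + t * (- a)\<^sup>2
        = r * (b - s / r * a)\<^sup>2 + (t - s\<^sup>2 / r) * a\<^sup>2"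
      using False by (simp add: field_simps power2_eq_square)
    moreover have "0 \<le> r * (b - s / r * a)\<^sup>2" "0 \<le> (t - s\<^sup>2 / r) * a\<^sup>2" using R by auto
    ultimately have "r * (b - s / r * a)\<^sup>2 = 0" "(t - s\<^sup>2 / r) * a\<^sup>2 = 0"
      using zero by linarith+
    then have "b = s / r * a" "t = s\<^sup>2 / r" using False a by auto
    then show ?thesis using False by (simp add: power2_eq_square)
  qed
  then show "s = r / a\<^sup>2 * (a * b)" using a by (simp add: field_simps power2_eq_square)
  have "t * a\<^sup>2 = r * b\<^sup>2" using * by algebra
  then show "t = r / a\<^sup>2 * b\<^sup>2" using a by (simp add: field_simps)
qed

text \<open>The two matrices are the outer squares of \<open>(a, b)\<close> and
  \<open>(a, c)\<close>, sharing the corner entry. Written with \<open>axis\<close>, the vector is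
  visibly continuous in \<open>a\<close>.\<close>

definition Vinberg_ray :: "real \<Rightarrow> real \<Rightarrow> real \<Rightarrow> real ^ 5" where
  "Vinberg_ray a b c = a\<^sup>2 *\<^sub>R axis 1 1 + (a * b) *\<^sub>R axis 2 1 + (a * c) *\<^sub>R axis 3 1
     + b\<^sup>2 *\<^sub>R axis 4 1 + c\<^sup>2 *\<^sub>R axis 5 1"

lemma Vinberg_ray_nth:
  "vec_nth (Vinberg_ray a b c) 1 = a\<^sup>2" "vec_nth (Vinberg_ray a b c) 2 = a * b"
  "vec_nth (Vinberg_ray a b c) 3 = a * c" "vec_nth (Vinberg_ray a b c) 4 = b\<^sup>2"
  "vec_nth (Vinberg_ray a b c) 5 = c\<^sup>2"
  by (simp_all add: Vinberg_ray_def axis_def)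

lemma Vinberg_ray_mem: "Vinberg_ray a b c \<in> Vinberg_cone"
proof -
  have "a\<^sup>2 * u\<^sup>2 + 2 * (a * b) * u * v + b\<^sup>2 * v\<^sup>2 = (a * u + b * v)\<^sup>2" for u v b :: real
    by (simp add: power2_eq_square algebra_simps)
  then show ?thesis unfolding mem_Vinberg_cone Vinberg_ray_nth by simp
qed

lemma cone_hull_singleton:
  fixes x :: "'a::real_vector"
  shows "cone hull {x} = {c *\<^sub>R x |c. 0 \<le> c}"
  by (auto simp: cone_hull_expl)

text \<open>The functionals \<open>\<phi>\<close> and \<open>\<psi>\<close> evaluate the two forms
  at \<open>(b, -a)\<close> and \<open>(c, -a)\<close>. They are linear in \<open>y\<close> and
  nonnegative on the cone, so their common zeros in it form a face. There both matrices have rank at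
  most one, and the shared corner entry gives them the same factor, as
  \<open>a \<noteq> 0\<close>.\<close>

lemma extreme_ray_Vinberg_ray:
  assumes a: "a \<noteq> 0"
  shows "extreme_ray_of (cone hull {Vinberg_ray a b c}) Vinberg_cone"
proof -
  let ?w = "Vinberg_ray a b c"
  define \<phi> where "\<phi> y = vec_nth y 1 * b\<^sup>2 + 2 * vec_nth y 2 * b * (- a) + vec_nth y 4 * (- a)\<^sup>2"
    for y :: "real ^ 5"
  define \<psi> where "\<psi> y = vec_nth y 1 * c\<^sup>2 + 2 * vec_nth y 3 * c * (- a) + vec_nth y 5 * (- a)\<^sup>2"
    for y :: "real ^ 5"
  have nonneg: "0 \<le> \<phi> y" "0 \<le> \<psi> y" if "y \<in> Vinberg_cone" for y
    using that unfolding mem_Vinberg_cone \<phi>_def \<psi>_def by blast+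
  have lin: "\<phi> (u *\<^sub>R y + v *\<^sub>R z) = u * \<phi> y + v * \<phi> z"
    "\<psi> (u *\<^sub>R y + v *\<^sub>R z) = u * \<psi> y + v * \<psi> z" for u v y z
    by (simp_all add: \<phi>_def \<psi>_def algebra_simps)
  have zero: "\<phi> (k *\<^sub>R ?w) = 0" "\<psi> (k *\<^sub>R ?w) = 0" for k
    by (simp_all add: \<phi>_def \<psi>_def Vinberg_ray_nth power2_eq_square)
  have ray: "y \<in> cone hull {?w}" if y: "y \<in> Vinberg_cone" "\<phi> y = 0" "\<psi> y = 0" for y
  proof -
    have 1: "\<forall>a b. 0 \<le> vec_nth y 1 * a\<^sup>2 + 2 * vec_nth y 2 * a * b + vec_nth y 4 * b\<^sup>2"
      and 2: "\<forall>a b. 0 \<le> vec_nth y 1 * a\<^sup>2 + 2 * vec_nth y 3 * a * b + vec_nth y 5 * b\<^sup>2"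
      using y(1) unfolding mem_Vinberg_cone by blast+
    have "y = (vec_nth y 1 / a\<^sup>2) *\<^sub>R ?w"
      using psd_form_zero[OF 1 a y(2)[unfolded \<phi>_def]] psd_form_zero[OF 2 a y(3)[unfolded \<psi>_def]] a
      by (simp add: vec_eq_iff forall_5 Vinberg_ray_nth)
    moreover have "0 \<le> vec_nth y 1 / a\<^sup>2" using 1[rule_format, of 1 0] by simp
    ultimately show ?thesis unfolding cone_hull_singleton by blast
  qed
  have "cone hull {?w} face_of Vinberg_cone"
    unfolding face_of_def
  proof (intro conjI ballI impI)
    show "cone hull {?w} \<subseteq> Vinberg_cone"
      using closed_convex_cone_Vinberg_cone(3) Vinberg_ray_mem by (simp add: hull_minimal)
    show "convex (cone hull {?w})" by (simp add: convex_cone_hull)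
    fix y z x
    assume yz: "y \<in> Vinberg_cone" "z \<in> Vinberg_cone" and x: "x \<in> cone hull {?w}"
      and seg: "x \<in> open_segment y z"
    obtain u where u: "0 < u" "u < 1" "x = (1 - u) *\<^sub>R y + u *\<^sub>R z"
      using seg by (auto simp: in_segment)
    have "\<phi> x = 0" "\<psi> x = 0" using x zero unfolding cone_hull_singleton by auto
    then have "(1 - u) * \<phi> y + u * \<phi> z = 0" "(1 - u) * \<psi> y + u * \<psi> z = 0"
      unfolding u(3) lin by simp_all
    moreover have "0 \<le> (1 - u) * \<phi> y" "0 \<le> u * \<phi> z" "0 \<le> (1 - u) * \<psi> y" "0 \<le> u * \<psi> z"
      using nonneg yz u by simp_all
    ultimately have "(1 - u) * \<phi> y = 0" "u * \<phi> z = 0" "(1 - u) * \<psi> y = 0" "u * \<psi> z = 0"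
      by linarith+
    then have "\<phi> y = 0" "\<phi> z = 0" "\<psi> y = 0" "\<psi> z = 0" using u by simp_all
    then show "y \<in> cone hull {?w}" "z \<in> cone hull {?w}" using ray yz by blast+
  qed
  moreover have "?w \<noteq> 0"
    using a Vinberg_ray_nth(1)[of a b c] by (metis power_not_zero zero_index)
  ultimately show ?thesis unfolding extreme_ray_of_def by blast
qed

text \<open>Changing coordinates 4 and 5 moves each lower right entry separately, and
  \<open>m\<close>, \<open>n\<close> are the Schur complements of \<open>e\<close>, the amounts by
  which these entries may drop.\<close>

lemma Vinberg_cone_quadrant:
  assumes e: "e \<in> Vinberg_cone"
  obtains m n where "\<And>c d. e + (c *\<^sub>R axis 4 1 + d *\<^sub>R axis 5 1) \<in> Vinberg_cone \<longleftrightarrow> - m \<le> c \<and> - n \<le> d"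
proof
  let ?m = "vec_nth e 4 - (vec_nth e 2)\<^sup>2 / vec_nth e 1"
  let ?n = "vec_nth e 5 - (vec_nth e 3)\<^sup>2 / vec_nth e 1"
  have E: "0 \<le> vec_nth e 1 \<and> (vec_nth e 1 = 0 \<longrightarrow> vec_nth e 2 = 0)
      \<and> (vec_nth e 2)\<^sup>2 / vec_nth e 1 \<le> vec_nth e 4"
    "0 \<le> vec_nth e 1 \<and> (vec_nth e 1 = 0 \<longrightarrow> vec_nth e 3 = 0)
      \<and> (vec_nth e 3)\<^sup>2 / vec_nth e 1 \<le> vec_nth e 5"
    using e unfolding mem_Vinberg_cone psd_form_iff by blast+
  fix c d :: real
  let ?y = "e + (c *\<^sub>R axis 4 1 + d *\<^sub>R axis 5 1)"
  have nth: "vec_nth ?y 1 = vec_nth e 1" "vec_nth ?y 2 = vec_nth e 2" "vec_nth ?y 3 = vec_nth e 3"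
    "vec_nth ?y 4 = vec_nth e 4 + c" "vec_nth ?y 5 = vec_nth e 5 + d"
    by (simp_all add: axis_def)
  show "?y \<in> Vinberg_cone \<longleftrightarrow> - ?m \<le> c \<and> - ?n \<le> d"
    unfolding mem_Vinberg_cone psd_form_iff nth using E by (auto simp: algebra_simps)
qed

section \<open>Affinity on the quadrant and the contradiction\<close>

theorem corollary4p2:
  shows "\<not> ROG_realizable Vinberg_cone"
proof
  assume "ROG_realizable Vinberg_cone"
  then obtain p e where hyp: "hyperbolic_along p e" and K: "Vinberg_cone = hyperbolicity_cone p e"
    and rog: "rank_one_generated p e"
    unfolding ROG_realizable_def by blast
  obtain d where pol: "real_polynomial_function p" and hom: "\<And>c x. p (c *\<^sub>R x) = c ^ d * p x"
    and pos: "p e > 0"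
    using hyp unfolding hyperbolic_along_def homogeneous_polynomial_def by blast
  have ray: "d > 0 \<and> (\<exists>l. \<forall>s. p (e + s *\<^sub>R Vinberg_ray a b c) = p e * (1 + l * s))"
    if a: "a \<noteq> 0" for a b c
  proof -
    let ?w = "Vinberg_ray a b c"
    obtain x where x: "cone hull {?w} = cone hull {x}" and rank: "hyperbolic_rank p e x = 1"
      using rog extreme_ray_Vinberg_ray[OF a] K unfolding rank_one_generated_def by metis
    have "?w \<in> cone hull {x}" using x hull_inc[of ?w "{?w}" cone] by simp
    then obtain k where k: "?w = k *\<^sub>R x" unfolding cone_hull_singleton by blast
    obtain l where l: "\<And>s. p (e + s *\<^sub>R x) = p e * (1 + l * s)"
      using rank_one_affine(2)[OF pol hom pos rank] by blast
    have "p (e + s *\<^sub>R ?w) = p e * (1 + (l * k) * s)" for s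
      using l[of "s * k"] by (simp add: k mult_ac)
    then show ?thesis using rank_one_affine(1)[OF pol hom pos rank] by blast
  qed
  then have d: "d > 0" using zero_neq_one by metis
  have cont: "isCont p x" for x
    using continuous_real_polymonial_function[OF pol] .
  have quad: "\<exists>l. \<forall>s. p (e + s *\<^sub>R (c *\<^sub>R axis 4 1 + f *\<^sub>R axis 5 1)) = p e * (1 + l * s)"
    if cf: "0 \<le> c" "0 \<le> f" for c f
  proof -
    \<comment> \<open>The square roots make the limit \<open>w 0\<close> the prescribed point of the
      quadrant.\<close>
    define w where "w a = Vinberg_ray a (sqrt c) (sqrt f)" for a
    have w0: "w 0 = c *\<^sub>R axis 4 1 + f *\<^sub>R axis 5 1" using cf by (simp add: w_def Vinberg_ray_def)
    have contw: "isCont (\<lambda>a. p (e + s *\<^sub>R w a)) 0" for s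
      unfolding w_def Vinberg_ray_def by (rule isCont_o2[OF _ cont]) (intro continuous_intros)
    \<comment> \<open>The slope depends on \<open>a\<close>, so affinity is restated as
      interpolation between the values at \<open>s = 0\<close> and \<open>s = 1\<close>, an identity
      that survives the limit \<open>a \<rightarrow> 0\<close>.\<close>
    have eq: "p (e + s *\<^sub>R w 0) = (1 - s) * p e + s * p (e + 1 *\<^sub>R w 0)" for s
    proof (rule isCont_eq_at_0[where f = "\<lambda>a. p (e + s *\<^sub>R w a)"
          and g = "\<lambda>a. (1 - s) * p e + s * p (e + 1 *\<^sub>R w a)"])
      show "isCont (\<lambda>a. p (e + s *\<^sub>R w a)) 0" by (rule contw)
      show "isCont (\<lambda>a. (1 - s) * p e + s * p (e + 1 *\<^sub>R w a)) 0"
        by (intro continuous_intros contw)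
      show "p (e + s *\<^sub>R w a) = (1 - s) * p e + s * p (e + 1 *\<^sub>R w a)" if a: "a \<noteq> 0" for a
      proof -
        obtain l where l: "\<And>s. p (e + s *\<^sub>R w a) = p e * (1 + l * s)"
          using ray[OF a] unfolding w_def by blast
        show ?thesis unfolding l by (simp add: algebra_simps)
      qed
    qed
    have "p (e + s *\<^sub>R w 0) = p e * (1 + (p (e + 1 *\<^sub>R w 0) / p e - 1) * s)" for s
      unfolding eq[of s] using pos by (simp add: algebra_simps)
    then show ?thesis unfolding w0 by blast
  qed
  have mem: "e + s *\<^sub>R x \<in> Vinberg_cone \<longleftrightarrow> 0 \<le> 1 + l * s"
    if "\<And>s. p (e + s *\<^sub>R x) = p e * (1 + l * s)" for x l s
    unfolding K using hyperbolicity_cone_affine_line[OF pol hom d pos that] .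
  have "e \<in> Vinberg_cone" using mem[of 0 0 0] by simp
  then obtain m n
    where Q: "\<And>c f. e + (c *\<^sub>R axis 4 1 + f *\<^sub>R axis 5 1) \<in> Vinberg_cone \<longleftrightarrow> - m \<le> c \<and> - n \<le> f"
    using Vinberg_cone_quadrant by metis
  have memQ: "\<exists>l. (\<forall>s. p (e + s *\<^sub>R (c *\<^sub>R axis 4 1 + f *\<^sub>R axis 5 1)) = p e * (1 + l * s)) \<and>
      (\<forall>s. - m \<le> s * c \<and> - n \<le> s * f \<longleftrightarrow> 0 \<le> 1 + l * s)"
    if cf: "0 \<le> c" "0 \<le> f" for c f
  proof -
    obtain l where l: "\<And>s. p (e + s *\<^sub>R (c *\<^sub>R axis 4 1 + f *\<^sub>R axis 5 1)) = p e * (1 + l * s)"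
      using quad[OF cf] by blast
    have "- m \<le> s * c \<and> - n \<le> s * f \<longleftrightarrow> 0 \<le> 1 + l * s" for s
      using mem[OF l, of s] Q[of "s * c" "s * f"] by (simp add: scaleR_add_right)
    with l show ?thesis by blast
  qed
  \<comment> \<open>The condition on an affine line tolerates a small backward step from
    \<open>e\<close>. Applied along each axis, this makes \<open>m\<close> and \<open>n\<close>
    strictly positive.\<close>
  have small: "\<exists>s<0. 0 \<le> 1 + l * s" for l :: real
    by (rule exI[of _ "- 1 / (\<bar>l\<bar> + 1)"]) (auto simp: field_simps)
  have m: "0 < m"
  proof -
    obtain l where l: "\<And>s. - m \<le> s \<and> - n \<le> 0 \<longleftrightarrow> 0 \<le> 1 + l * s" using memQ[of 1 0] by auto
    obtain s where "s < 0" "0 \<le> 1 + l * s" using small by blast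
    then show ?thesis using l[of s] by simp
  qed
  have n: "0 < n"
  proof -
    obtain l where l: "\<And>s. - m \<le> 0 \<and> - n \<le> s \<longleftrightarrow> 0 \<le> 1 + l * s" using memQ[of 0 1] by auto
    obtain s where "s < 0" "0 \<le> 1 + l * s" using small by blast
    then show ?thesis using l[of s] by simp
  qed
  \<comment> \<open>In the units \<open>m\<close>, \<open>n\<close> the apex of the quadrant lies at
    \<open>(-1, -1)\<close> relative to \<open>e\<close>.\<close>
  define P where "P = line_poly p (e + m *\<^sub>R axis 4 1) (n *\<^sub>R axis 5 1)"
  have P: "poly P u = p e * (1 + max 1 u)" if u: "0 \<le> u" for u
  proof -
    obtain l where l: "\<And>s. p (e + s *\<^sub>R (m *\<^sub>R axis 4 1 + (n * u) *\<^sub>R axis 5 1)) = p e * (1 + l * s)"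
      and s: "\<And>s. - m \<le> s * m \<and> - n \<le> s * (n * u) \<longleftrightarrow> 0 \<le> 1 + l * s"
      using memQ[of m "n * u"] m n u by auto
    have "- m \<le> s * m \<longleftrightarrow> 0 \<le> 1 + s" for s
    proof -
      have "- m \<le> s * m \<longleftrightarrow> 0 \<le> m * (1 + s)" by (auto simp: algebra_simps)
      then show ?thesis using m by (simp add: zero_le_mult_iff)
    qed
    moreover have "- n \<le> s * (n * u) \<longleftrightarrow> 0 \<le> 1 + s * u" for s
    proof -
      have "- n \<le> s * (n * u) \<longleftrightarrow> 0 \<le> n * (1 + s * u)" by (auto simp: algebra_simps)
      then show ?thesis using n by (simp add: zero_le_mult_iff)
    qed
    ultimately have s: "0 \<le> 1 + s \<and> 0 \<le> 1 + s * u \<longleftrightarrow> 0 \<le> 1 + l * s" for s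
      using s by blast
    \<comment> \<open>At \<open>s = -2\<close> the quadrant is left, whereas a slope
      \<open>l \<le> 0\<close> would keep the point in the cone.\<close>
    have lpos: "0 < l"
    proof (rule ccontr)
      assume "\<not> 0 < l"
      then have "0 \<le> 1 + l * (-2)" by simp
      then show False using s[of "-2"] by simp
    qed
    \<comment> \<open>Moving backward, the quadrant is left at \<open>s = -1 / max 1 u\<close> and
      the affine function vanishes at \<open>s = -1 / l\<close>. Testing \<open>s\<close> at each of
      these values gives both inequalities between \<open>l\<close> and
      \<open>max 1 u\<close>.\<close>
    have le: "l \<le> max 1 u"
      using s[of "- 1 / max 1 u"] by (auto simp: field_simps max_def split: if_splits)
    have "1 \<le> l" "u \<le> l" using s[of "- 1 / l"] lpos by (auto simp: field_simps)
    with le have "l = max 1 u" by simp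
    moreover have "poly P u = p (e + 1 *\<^sub>R (m *\<^sub>R axis 4 1 + (n * u) *\<^sub>R axis 5 1))"
      unfolding P_def poly_line_poly[OF pol] by (simp add: algebra_simps)
    ultimately show ?thesis unfolding l by simp
  qed
  \<comment> \<open>\<open>P\<close> is constant on the unit interval, hence everywhere, but its
    value at 2 would be \<open>3 * p e\<close>.\<close>
  have "P = [:2 * p e:]"
  proof (rule ccontr)
    assume "P \<noteq> [:2 * p e:]"
    then have "finite {u. poly (P - [:2 * p e:]) u = 0}" by (intro poly_roots_finite) simp
    moreover have "{0..1} \<subseteq> {u. poly (P - [:2 * p e:]) u = 0}" using P by (auto simp: max_def)
    ultimately have "finite {0..1::real}" using finite_subset by blast
    then show False by (simp add: infinite_Icc)
  qed
  then show False using P[of 2] pos by simp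
qed

end
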